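(* For topological spaces $X$ and $Y$, the product $X\times Y$ is HLC if and only if both $X$ and $Y$ are HLC.
   Context: A space $X$ is homologically locally connected (HLC) if for every $x\in X$, every neighbourhood $U$ of $x$ and every $n\ge 0$ there exists a neighbourhood $V\subseteq U$ of $x$ such that the map $\tilde H_n(V)\to\tilde H_n(U)$ induced by inclusion is zero, where $\tilde H_n$ is reduced singular homology with coefficients in $\mathbb{Z}$.
   Formalization: The spaces X and Y are assumed to be nonempty; otherwise the claim fails, since for X empty the product is empty and so vacuously HLC, while Y (e.g. a convergent sequence with its limit) need not be HLC. *)

theory Defs
  imports "HOL-Homology.Homology"
begin

definition nbhd_of :: "'a topology \<Rightarrow> 'a \<Rightarrow> 'a set \<Rightarrow> bool" where
  "nbhd_of X x U \<longleftrightarrow> U \<subseteq> topspace X \<and> (\<exists>W. openin X W \<and> x \<in> W \<and> W \<subseteq> U)"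

definition HLC :: "'a topology \<Rightarrow> bool" where
  "HLC X \<longleftrightarrow>
     (\<forall>x \<in> topspace X. \<forall>U. \<forall>n::nat. nbhd_of X x U \<longrightarrow>
        (\<exists>V. nbhd_of X x V \<and> V \<subseteq> U \<and>
           (\<forall>c \<in> carrier (reduced_homology_group (int n) (subtopology X V)).
              hom_induced (int n) (subtopology X V) {} (subtopology X U) {} id c
                = \<one>\<^bsub>homology_group (int n) (subtopology X U)\<^esub>)))"

end

theory Submission
  imports Defs
begin

text \<open>
  That a retract of an HLC space is HLC gives one direction, both factors being retracts of the product.

  The converse needs no Kuenneth formula. Shrinking neighbourhoods step by step, HLC of \<open>X\<close> at \<open>x\<close>
  allows one to choose, by induction on \<open>n\<close>, for every singular \<open>n\<close>-simplex \<open>s\<close> of a small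
  neighbourhood \<open>V\<close> of \<open>x\<close>, an \<open>(n+1)\<close>-chain \<open>E s\<close> in \<open>U \<times> \<Delta>\<^sup>n\<close> joining the graph of \<open>s\<close> to the
  graph of the constant \<open>x\<close>, compatibly with faces: since \<open>\<Delta>\<^sup>n\<close> is contractible, the cycle to be
  filled behaves as a cycle of \<open>X\<close>. Pushing \<open>E (fst \<circ> f)\<close> forward along \<open>id \<times> (snd \<circ> f)\<close> for singular
  simplices \<open>f\<close> of \<open>V \<times> Y\<close> yields a chain homotopy from the inclusion \<open>V \<times> Y \<subseteq> U \<times> Y\<close> to
  \<open>(v, y) \<mapsto> (x, y)\<close>, so cycles can be moved into the fibre over \<open>x\<close>, where HLC of \<open>Y\<close> applies.
\<close>

section \<open>Reduced cycles\<close>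

text \<open>The second conjunct expresses membership in the kernel of the map to the homology of a
  point, which is how the library defines reduced homology. It has content only for
  \<open>n = 0\<close>, where it says that the coefficients sum to zero.\<close>

definition reduced_cycle :: "nat \<Rightarrow> 'a topology \<Rightarrow> 'a chain \<Rightarrow> bool" where
  "reduced_cycle n X c \<longleftrightarrow> singular_relcycle n X {} c \<and>
     singular_relboundary n (discrete_topology {()}) {} (chain_map n (\<lambda>x. ()) c)"

text \<open>Meant for \<open>S\<close> a subspace of \<open>T\<close>: a chain of \<open>S\<close>
  is then literally a chain of \<open>T\<close>, so the inclusion need not appear.\<close>

definition reduced_null :: "nat \<Rightarrow> 'a topology \<Rightarrow> 'a topology \<Rightarrow> bool" where
  "reduced_null n S T \<longleftrightarrow> (\<forall>c. reduced_cycle n S c \<longrightarrow> singular_relboundary n T {} c)"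

lemma reduced_nullD:
  "\<lbrakk>reduced_null n S T; reduced_cycle n S c\<rbrakk> \<Longrightarrow> singular_relboundary n T {} c"
  by (simp add: reduced_null_def)

lemma carrier_reduced_homology_group_chain:
  "carrier (reduced_homology_group (int n) X) = homologous_rel_set n X {} ` Collect (reduced_cycle n X)"
proof -
  have "homologous_rel_set n X {} c \<in> carrier (reduced_homology_group (int n) X) \<longleftrightarrow> reduced_cycle n X c"
    if "singular_relcycle n X {} c" for c
    using that
    by (auto simp: carrier_reduced_homology_group kernel_def carrier_relative_homology_group
        hom_induced_chain_map_gen homologous_rel_set_eq_relboundary reduced_cycle_def)
  then show ?thesis
    using carrier_reduced_homology_group_subset [of "int n" X]
    by (auto simp: carrier_relative_homology_group reduced_cycle_def)
qed

text \<open>The inclusion fixes every chain of \<open>V\<close>, so a class dies in \<open>U\<close>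
  exactly when its representing cycle bounds there. From here on only chains are used, no homology
  groups.\<close>

lemma hom_induced_trivial_iff_reduced_null:
  assumes "V \<subseteq> U"
  shows "(\<forall>c \<in> carrier (reduced_homology_group (int n) (subtopology X V)).
            hom_induced (int n) (subtopology X V) {} (subtopology X U) {} id c
              = \<one>\<^bsub>homology_group (int n) (subtopology X U)\<^esub>)
         \<longleftrightarrow> reduced_null n (subtopology X V) (subtopology X U)"
proof -
  have cont: "continuous_map (subtopology X V) (subtopology X U) id"
    using assms by (auto simp: continuous_map_in_subtopology continuous_map_from_subtopology)
  have "hom_induced (int n) (subtopology X V) {} (subtopology X U) {} id
          (homologous_rel_set n (subtopology X V) {} c) = \<one>\<^bsub>homology_group (int n) (subtopology X U)\<^esub>
        \<longleftrightarrow> singular_relboundary n (subtopology X U) {} c"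
    if "reduced_cycle n (subtopology X V) c" for c
  proof -
    have cyc: "singular_relcycle n (subtopology X V) {} c"
      using that by (simp add: reduced_cycle_def)
    then have "chain_map n id c = c"
      by (meson chain_map_ident singular_cycle)
    with cyc show ?thesis
      by (simp add: hom_induced_chain_map_gen [OF cont] homologous_rel_set_eq_relboundary)
  qed
  then show ?thesis
    by (auto simp: carrier_reduced_homology_group_chain reduced_null_def)
qed

lemma HLC_iff_reduced_null:
  "HLC X \<longleftrightarrow> (\<forall>x \<in> topspace X. \<forall>U n. nbhd_of X x U \<longrightarrow>
     (\<exists>V. nbhd_of X x V \<and> V \<subseteq> U \<and> reduced_null n (subtopology X V) (subtopology X U)))"
  unfolding HLC_def using hom_induced_trivial_iff_reduced_null by metis

lemma HLC_D:
  assumes "HLC X" "x \<in> topspace X" "nbhd_of X x U"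
  obtains V where "nbhd_of X x V" "V \<subseteq> U" "reduced_null n (subtopology X V) (subtopology X U)"
  using assms unfolding HLC_iff_reduced_null by blast

lemma chain_map_compose_apply: "chain_map n h (chain_map n g c) = chain_map n (h \<circ> g) c"
  by (simp add: chain_map_compose)

lemma reduced_cycle_chain_map:
  assumes "reduced_cycle n X c" "continuous_map X Y f"
  shows "reduced_cycle n Y (chain_map n f c)"
  using assms singular_relcycle_chain_map [of n X "{}" c Y f "{}"]
  by (simp add: reduced_cycle_def chain_map_compose_apply o_def)

text \<open>The inclusion of \<open>S\<close> into \<open>T\<close> factors as \<open>i\<close>,
  then the inclusion of \<open>S'\<close> into \<open>T'\<close>, then \<open>r\<close>; the middle
  map kills reduced cycles.\<close>

lemma reduced_null_factor:
  assumes null: "reduced_null n S' T'"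
    and i: "continuous_map S S' i" and r: "continuous_map T' T r"
    and eq: "\<And>x. x \<in> topspace S \<Longrightarrow> r (i x) = x"
  shows "reduced_null n S T"
  unfolding reduced_null_def
proof (intro allI impI)
  fix c assume c: "reduced_cycle n S c"
  then have "singular_relboundary n T' {} (chain_map n i c)"
    using null i by (blast intro: reduced_nullD reduced_cycle_chain_map)
  then have "singular_relboundary n T {} (chain_map n r (chain_map n i c))"
    using r by (rule singular_relboundary_chain_map) auto
  moreover have "chain_map n r (chain_map n i c) = c"
    using c eq
    by (metis chain_map_compose_apply chain_map_id_gen comp_apply reduced_cycle_def singular_cycle)
  ultimately show "singular_relboundary n T {} c"
    by simp
qed

section \<open>Contractible factors and the standard simplex\<close>

lemma singular_relboundary_homotopic:
  assumes "homotopic_with (\<lambda>h. True) X Y f g" "singular_relcycle n X {} c"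
    and "singular_relboundary n Y {} (chain_map n g c)"
  shows "singular_relboundary n Y {} (chain_map n f c)"
proof -
  have "homologous_rel n Y {} (chain_map n f c) (chain_map n g c)"
    using assms(1,2) by (intro homotopic_imp_homologous_rel_chain_maps [where T="{}"]) auto
  then show ?thesis
    using assms(3) singular_relboundary_add [of n Y "{}"] by (fastforce simp: homologous_rel_def)
qed

text \<open>Contracting \<open>C\<close> to a point \<open>a\<close> deforms the inclusion into the
  map that projects to \<open>V\<close>, includes into \<open>U\<close> and returns to the slice at
  \<open>a\<close>; this composite kills reduced cycles by \<open>null\<close>.\<close>

lemma reduced_null_prod_contractible:
  assumes null: "reduced_null n (subtopology X V) (subtopology X U)" and "V \<subseteq> U"
    and C: "contractible_space C"
  shows "reduced_null n (prod_topology (subtopology X V) C) (prod_topology (subtopology X U) C)"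
\<comment> \<open>The empty space counts as contractible but offers no slice; all chains are then
  zero.\<close>
proof (cases "topspace C = {}")
  case True
  then show ?thesis
    by (auto simp: reduced_null_def reduced_cycle_def singular_cycle singular_chain_empty)
next
  case False
  let ?V = "subtopology X V" and ?U = "subtopology X U"
  obtain a where a: "homotopic_with (\<lambda>x. True) C C id (\<lambda>x. a)"
    using C by (auto simp: contractible_space_def)
  then have "a \<in> topspace C"
    using False by (metis continuous_map_const homotopic_with_imp_continuous_maps null_topspace_iff_trivial)
  have cont: "continuous_map ?V ?U id"
    using \<open>V \<subseteq> U\<close> by (auto simp: continuous_map_in_subtopology continuous_map_from_subtopology)
  show ?thesis
    unfolding reduced_null_def
  proof (intro allI impI)
    fix c assume c: "reduced_cycle n (prod_topology ?V C) c"
    \<comment> \<open>The inclusion, written with \<open>id\<close> in each coordinate to match the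
      product rule for homotopies.\<close>
    let ?f = "\<lambda>z. (id (fst z), id (snd z))" and ?g = "\<lambda>z. (id (fst z), a)"
    have hom: "homotopic_with (\<lambda>h. True) (prod_topology ?V C) (prod_topology ?U C) ?f ?g"
      by (intro homotopic_with_prod_topology [where p="\<lambda>x. True" and q="\<lambda>x. True"])
        (use cont a in \<open>auto simp: id_def\<close>)
    have "singular_relboundary n ?U {} (chain_map n fst c)"
      using c null continuous_map_fst by (blast intro: reduced_nullD reduced_cycle_chain_map)
    moreover have "continuous_map ?U (prod_topology ?U C) (\<lambda>x. (x, a))"
      using \<open>a \<in> topspace C\<close> by (simp add: continuous_map_pairedI)
    ultimately have "singular_relboundary n (prod_topology ?U C) {}
                       (chain_map n (\<lambda>x. (x, a)) (chain_map n fst c))"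
      by (rule singular_relboundary_chain_map) auto
    then have "singular_relboundary n (prod_topology ?U C) {} (chain_map n ?g c)"
      by (simp add: chain_map_compose_apply o_def)
    then have "singular_relboundary n (prod_topology ?U C) {} (chain_map n ?f c)"
      using c hom by (intro singular_relboundary_homotopic [OF hom]) (auto simp: reduced_cycle_def)
    moreover have "chain_map n ?f c = c"
      using c by (intro chain_map_id_gen) (auto simp: reduced_cycle_def singular_cycle)
    ultimately show "singular_relboundary n (prod_topology ?U C) {} c"
      by simp
  qed
qed

abbreviation simplex_topology :: "nat \<Rightarrow> (nat \<Rightarrow> real) topology" where
  "simplex_topology n \<equiv> subtopology (powertop_real UNIV) (standard_simplex n)"

lemma topspace_simplex_topology: "topspace (simplex_topology n) = standard_simplex n"
  by (simp add: topspace_standard_simplex)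

text \<open>By convexity the straight-line homotopy to any point \<open>a\<close> stays in the
  simplex; its continuity is checked coordinatewise.\<close>

lemma contractible_space_standard_simplex: "contractible_space (simplex_topology n)"
proof -
  obtain a where a: "a \<in> standard_simplex n"
    using nonempty_standard_simplex by blast
  let ?h = "\<lambda>(t::real, x::nat\<Rightarrow>real) i. (1 - t) * x i + t * a i"
  have "continuous_map (prod_topology (top_of_set {0..1}) (simplex_topology n)) euclideanreal
          (\<lambda>z. (1 - fst z) * snd z i + fst z * a i)" for i
  proof -
    have "continuous_map (simplex_topology n) euclideanreal (\<lambda>x. x i)"
      by (intro continuous_map_from_subtopology continuous_map_product_projection) auto
    then have "continuous_map (prod_topology (top_of_set {0..1}) (simplex_topology n)) euclideanreal
            (\<lambda>z. snd z i)"
      using continuous_map_compose [OF continuous_map_snd] by (fastforce simp: o_def)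
    moreover have "continuous_map (prod_topology (top_of_set {0..1}) (simplex_topology n)) euclideanreal fst"
      using continuous_map_fst continuous_map_in_subtopology by blast
    ultimately show ?thesis
      by (intro continuous_intros) auto
  qed
  then have "continuous_map (prod_topology (top_of_set {0..1}) (simplex_topology n)) (powertop_real UNIV) ?h"
    by (simp add: continuous_map_componentwise_UNIV case_prod_unfold)
  moreover have "?h \<in> topspace (prod_topology (top_of_set {0..1}) (simplex_topology n)) \<rightarrow> standard_simplex n"
    using a by (auto simp: topspace_simplex_topology intro!: convex_standard_simplex)
  ultimately have "continuous_map (prod_topology (top_of_set {0..1}) (simplex_topology n)) (simplex_topology n) ?h"
    by (simp add: continuous_map_in_subtopology)
  then have "homotopic_with (\<lambda>x. True) (simplex_topology n) (simplex_topology n) id (\<lambda>x. a)"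
    unfolding homotopic_with_def by (intro exI [of _ ?h]) (auto simp: id_def)
  then show ?thesis
    by (auto simp: contractible_space_def)
qed

section \<open>A chain homotopy on products\<close>

text \<open>Restricted to the standard simplex because singular simplices are required to be
  extensional.\<close>

definition graph_simplex :: "nat \<Rightarrow> ((nat \<Rightarrow> real) \<Rightarrow> 'a) \<Rightarrow> (nat \<Rightarrow> real) \<Rightarrow> 'a \<times> (nat \<Rightarrow> real)" where
  "graph_simplex n s = (\<lambda>t \<in> standard_simplex n. (s t, t))"

text \<open>The graph is the universal case: \<open>id\<close> times \<open>snd \<circ> f\<close>
  carries the graph of the first component of \<open>f\<close> to \<open>f\<close>, hence a chain
  contracting that graph to one contracting the first coordinate of \<open>f\<close>.\<close>

definition push_homotopy ::
  "(nat \<Rightarrow> ((nat \<Rightarrow> real) \<Rightarrow> 'a) \<Rightarrow> ('a \<times> (nat \<Rightarrow> real)) chain) \<Rightarrow> nat \<Rightarrow> ('a \<times> 'b) chain \<Rightarrow> ('a \<times> 'b) chain" where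
  "push_homotopy E n =
     frag_extend (\<lambda>f. chain_map (Suc n) (map_prod id (snd \<circ> f)) (E n (simplex_map n fst f)))"

text \<open>
  For \<open>n = 0\<close> the truncated \<open>n - 1\<close> below is harmless: the boundary of a 0-chain is \<open>0\<close>.
\<close>
definition graph_contraction ::
  "nat \<Rightarrow> 'a topology \<Rightarrow> 'a topology \<Rightarrow> 'a
    \<Rightarrow> (nat \<Rightarrow> ((nat \<Rightarrow> real) \<Rightarrow> 'a) \<Rightarrow> ('a \<times> (nat \<Rightarrow> real)) chain) \<Rightarrow> bool" where
  "graph_contraction N S T x E \<longleftrightarrow>
     (\<forall>n<N. \<forall>s. singular_simplex n S s \<longrightarrow>
        singular_chain (Suc n) (prod_topology T (simplex_topology n)) (E n s) \<and>
        chain_boundary (Suc n) (E n s) =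
          frag_of (graph_simplex n s) - frag_of (graph_simplex n (\<lambda>t. x))
            - push_homotopy E (n - 1) (chain_boundary n (frag_of (graph_simplex n s))))"

lemma push_homotopy_0 [simp]: "push_homotopy E n 0 = 0"
  by (simp add: push_homotopy_def)

lemma push_homotopy_diff: "push_homotopy E n (a - b) = push_homotopy E n a - push_homotopy E n b"
  by (simp add: push_homotopy_def frag_extend_diff)

lemma push_homotopy_of:
  "push_homotopy E n (frag_of f) = chain_map (Suc n) (map_prod id (snd \<circ> f)) (E n (simplex_map n fst f))"
  by (simp add: push_homotopy_def)

section \<open>The chain homotopy formula\<close>

lemma continuous_map_map_prod:
  assumes "continuous_map X X' f" "continuous_map Y Y' g"
  shows "continuous_map (prod_topology X Y) (prod_topology X' Y') (map_prod f g)"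
  using assms by (simp add: map_prod_def continuous_map_prod_top)

lemma singular_simplex_snd:
  assumes "singular_simplex n (prod_topology S Y) f"
  shows "continuous_map (simplex_topology n) Y (snd \<circ> f)"
  using assms continuous_map_snd by (auto simp: singular_simplex_def intro: continuous_map_compose)

lemma singular_simplex_fst:
  assumes "singular_simplex n (prod_topology S Y) f"
  shows "singular_simplex n S (simplex_map n fst f)"
  using assms continuous_map_fst by (rule singular_simplex_simplex_map)

lemma singular_simplex_graph:
  assumes "continuous_map (simplex_topology n) S s"
  shows "singular_simplex n (prod_topology S (simplex_topology n)) (graph_simplex n s)"
proof -
  have "continuous_map (simplex_topology n) (prod_topology S (simplex_topology n)) (\<lambda>t. (s t, t))"
    using assms by (simp add: continuous_map_pairedI)
  then have "continuous_map (simplex_topology n) (prod_topology S (simplex_topology n)) (graph_simplex n s)"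
    by (rule continuous_map_eq) (simp add: graph_simplex_def topspace_simplex_topology)
  then show ?thesis
    by (simp add: singular_simplex_def graph_simplex_def)
qed

lemma graph_simplex_push:
  assumes "singular_simplex n X f"
  shows "simplex_map n (map_prod id (snd \<circ> f)) (graph_simplex n (simplex_map n fst f)) = f"
proof
  fix t
  show "simplex_map n (map_prod id (snd \<circ> f)) (graph_simplex n (simplex_map n fst f)) t = f t"
    using assms
    by (cases "t \<in> standard_simplex n")
      (auto simp: simplex_map_def graph_simplex_def singular_simplex_def extensional_def)
qed

lemma singular_chain_push_homotopy:
  assumes E: "graph_contraction N S T x E" and "n < N"
    and c: "singular_chain n (prod_topology S Y) c"
  shows "singular_chain (Suc n) (prod_topology T Y) (push_homotopy E n c)"
  unfolding push_homotopy_def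
proof (rule singular_chain_extend)
  fix f assume "f \<in> Poly_Mapping.keys c"
  then have f: "singular_simplex n (prod_topology S Y) f"
    using c by (auto simp: singular_chain_def)
  have "singular_chain (Suc n) (prod_topology T (simplex_topology n)) (E n (simplex_map n fst f))"
    using E \<open>n < N\<close> singular_simplex_fst [OF f] by (simp add: graph_contraction_def)
  then show "singular_chain (Suc n) (prod_topology T Y)
               (chain_map (Suc n) (map_prod id (snd \<circ> f)) (E n (simplex_map n fst f)))"
    by (rule singular_chain_chain_map)
      (intro continuous_map_map_prod continuous_map_id singular_simplex_snd [OF f])
qed

text \<open>Changing the second coordinate by \<open>g\<close> leaves the first component of a
  simplex alone, so the same chain of \<open>E\<close> is pushed forward, only along a map composed
  with \<open>g\<close>.\<close>

lemma push_homotopy_natural: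
  assumes E: "graph_contraction N S T x E" and "n < N"
    and c: "singular_chain n (prod_topology S Y) c"
  shows "push_homotopy E n (chain_map n (map_prod id g) c)
       = chain_map (Suc n) (map_prod id g) (push_homotopy E n c)"
  using c unfolding singular_chain_def
proof (induction c rule: frag_induction)
  case (one f)
  then have f: "singular_simplex n (prod_topology S Y) f"
    by simp
  let ?s = "simplex_map n fst f" and ?f = "simplex_map n (map_prod id g) f"
  have s: "simplex_map n fst ?f = ?s"
    by (auto simp: simplex_map_def)
  have ch: "singular_chain (Suc n) (prod_topology T (simplex_topology n)) (E n ?s)"
    using E \<open>n < N\<close> singular_simplex_fst [OF f] by (simp add: graph_contraction_def)
  have "chain_map (Suc n) (map_prod id (snd \<circ> ?f)) (E n ?s)
      = chain_map (Suc n) (map_prod id g \<circ> map_prod id (snd \<circ> f)) (E n ?s)"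
    \<comment> \<open>The two maps agree only over the standard simplex, as
      \<open>simplex_map\<close> restricts; that suffices because \<open>E n ?s\<close> lives
      there.\<close>
    by (rule chain_map_eq [OF ch]) (auto simp: topspace_simplex_topology simplex_map_def)
  then show ?case
    by (simp only: push_homotopy_of chain_map_of s chain_map_compose_apply)
qed (auto simp: push_homotopy_diff chain_map_diff)

text \<open>The chain homotopy identity between the inclusion and the collapse of the first
  coordinate to \<open>x\<close>. For a graph it is the defining equation of \<open>E\<close>;
  pushing that equation forward along \<open>?g\<close> gives it for \<open>f\<close>.\<close>

lemma chain_boundary_push_homotopy:
  assumes E: "graph_contraction N S T x E" and "n < N"
    and c: "singular_chain n (prod_topology S Y) c"
  shows "chain_boundary (Suc n) (push_homotopy E n c)
       = c - chain_map n (\<lambda>z. (x, snd z)) c - push_homotopy E (n - 1) (chain_boundary n c)"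
  using c unfolding singular_chain_def
proof (induction c rule: frag_induction)
  case (one f)
  then have f: "singular_simplex n (prod_topology S Y) f"
    by simp
  let ?s = "simplex_map n fst f" and ?g = "map_prod id (snd \<circ> f)"
  note s = singular_simplex_fst [OF f]
  have gr: "singular_simplex n (prod_topology S (simplex_topology n)) (graph_simplex n ?s)"
    using s by (intro singular_simplex_graph) (simp add: singular_simplex_def)
  have ch: "singular_chain (Suc n) (prod_topology T (simplex_topology n)) (E n ?s)"
   and bd: "chain_boundary (Suc n) (E n ?s) =
          frag_of (graph_simplex n ?s) - frag_of (graph_simplex n (\<lambda>t. x))
            - push_homotopy E (n - 1) (chain_boundary n (frag_of (graph_simplex n ?s)))"
    using E \<open>n < N\<close> s by (auto simp: graph_contraction_def)
  have const: "simplex_map n ?g (graph_simplex n (\<lambda>t. x)) = simplex_map n (\<lambda>z. (x, snd z)) f"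
    by (auto simp: simplex_map_def graph_simplex_def)
  \<comment> \<open>Naturality one degree lower moves \<open>?g\<close> inside, where it commutes
    with the boundary and turns the graph back into \<open>f\<close>.\<close>
  have push: "chain_map n ?g (push_homotopy E (n - 1) (chain_boundary n (frag_of (graph_simplex n ?s))))
            = push_homotopy E (n - 1) (chain_boundary n (frag_of f))"
  proof (cases "n = 0")
    case False
    then have "chain_map n ?g (push_homotopy E (n - 1) (chain_boundary n (frag_of (graph_simplex n ?s))))
        = push_homotopy E (n - 1) (chain_map (n - 1) ?g (chain_boundary n (frag_of (graph_simplex n ?s))))"
      using push_homotopy_natural [OF E, of "n - 1" "simplex_topology n" _ "snd \<circ> f"] \<open>n < N\<close>
        singular_chain_boundary [of n _ "frag_of (graph_simplex n ?s)"] gr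
      by (simp add: singular_chain_of)
    also have "chain_map (n - 1) ?g (chain_boundary n (frag_of (graph_simplex n ?s)))
             = chain_boundary n (chain_map n ?g (frag_of (graph_simplex n ?s)))"
      using gr chain_boundary_chain_map [of n _ "frag_of (graph_simplex n ?s)" ?g]
      by (simp add: singular_chain_of)
    finally show ?thesis
      by (simp only: chain_map_of graph_simplex_push [OF f])
  qed (simp add: chain_boundary_def)
  have "chain_boundary (Suc n) (push_homotopy E n (frag_of f))
      = chain_map n ?g (chain_boundary (Suc n) (E n ?s))"
    using chain_boundary_chain_map [OF ch] by (simp add: push_homotopy_of)
  also have "\<dots> = frag_of f - frag_of (simplex_map n (\<lambda>z. (x, snd z)) f)
                  - push_homotopy E (n - 1) (chain_boundary n (frag_of f))"
    unfolding bd chain_map_diff push by (simp add: graph_simplex_push [OF f] const)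
  finally show ?case
    by simp
next
  case (diff a b)
  then show ?case
    by (simp add: push_homotopy_diff chain_boundary_diff chain_map_diff)
qed auto

section \<open>Construction of the graph contraction degree by degree\<close>

lemma singular_chain_prod_mono:
  assumes "singular_chain n (prod_topology (subtopology X A) C) c" "A \<subseteq> B"
  shows "singular_chain n (prod_topology (subtopology X B) C) c"
  using assms singular_chain_mono [of n "prod_topology X C" "A \<times> topspace C" c "B \<times> topspace C"]
  by (auto simp: prod_topology_subtopology(1))

text \<open>In positive degree every cycle of a one-point space is a boundary.\<close>

lemma reduced_cycle_positive:
  assumes "singular_relcycle n X {} c" "0 < n"
  shows "reduced_cycle n X c"
proof -
  have "singular_relcycle n (discrete_topology {()}) {} (chain_map n (\<lambda>x. ()) c)"
    using assms(1) by (rule singular_relcycle_chain_map) auto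
  then show ?thesis
    using assms by (simp add: reduced_cycle_def singular_boundary_eq_cycle_singleton [where a="()"])
qed

text \<open>The prescribed boundary of the new chain is a reduced cycle over \<open>W\<close>; as
  the simplex is contractible, \<open>null\<close> provides a filling over \<open>U\<close>.\<close>

lemma graph_contraction_Suc:
  assumes E: "graph_contraction N (subtopology X V) (subtopology X W) x E"
    and "V \<subseteq> W" "W \<subseteq> U" and x: "x \<in> topspace X" "x \<in> W"
    and null: "reduced_null N (subtopology X W) (subtopology X U)"
  shows "\<exists>E'. graph_contraction (Suc N) (subtopology X V) (subtopology X U) x E'"
proof -
  let ?P = "\<lambda>A n. prod_topology (subtopology X A) (simplex_topology n)"
  \<comment> \<open>The right-hand side of the equation that \<open>E' N s\<close> has to
    satisfy.\<close>
  define B where "B s = frag_of (graph_simplex N s) - frag_of (graph_simplex N (\<lambda>t. x))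
            - push_homotopy E (N - 1) (chain_boundary N (frag_of (graph_simplex N s)))" for s
  have B_bounds: "\<exists>d. singular_chain (Suc N) (?P U N) d \<and> chain_boundary (Suc N) d = B s"
    if s: "singular_simplex N (subtopology X V) s" for s
  proof -
    let ?g = "frag_of (graph_simplex N s)"
    have g: "singular_chain N (?P V N) ?g"
      using s unfolding singular_chain_of by (intro singular_simplex_graph) (simp add: singular_simplex_def)
    have x_ch: "singular_chain N (?P W N) (frag_of (graph_simplex N (\<lambda>t. x)))"
      using x by (simp add: singular_chain_of singular_simplex_graph)
    have push_ch: "singular_chain N (?P W N) (push_homotopy E (N - 1) (chain_boundary N ?g))"
    proof (cases N)
      case (Suc M)
      then show ?thesis
        using singular_chain_push_homotopy [OF E, of M] singular_chain_boundary [OF g] by simp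
    qed (simp add: chain_boundary_def)
    have B_ch: "singular_chain N (?P W N) (B s)"
      unfolding B_def using singular_chain_prod_mono [OF g \<open>V \<subseteq> W\<close>] x_ch push_ch
      by (intro singular_chain_diff)
    have "reduced_cycle N (?P W N) (B s)"
    proof (cases N)
      \<comment> \<open>The correction term vanishes and \<open>B s\<close> is a difference of two
        points, which cancel in the one-point space.\<close>
      case 0
      then show ?thesis
        using B_ch by (simp add: reduced_cycle_def singular_cycle B_def chain_boundary_def chain_map_diff
            simplex_map_def graph_simplex_def o_def cong: restrict_cong)
    next
      case (Suc M)
      have "simplex_map N (\<lambda>z. (x, snd z)) (graph_simplex N s) = graph_simplex N (\<lambda>t. x)"
        by (auto simp: simplex_map_def graph_simplex_def)
      then have "chain_map M (\<lambda>z. (x, snd z)) (chain_boundary N ?g)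
               = chain_boundary N (frag_of (graph_simplex N (\<lambda>t. x)))"
        using chain_boundary_chain_map [OF g, of "\<lambda>z. (x, snd z)"] Suc by simp
      moreover have "chain_boundary M (chain_boundary N ?g) = 0"
        using g Suc chain_boundary_boundary_alt by blast
      moreover have "singular_chain M (?P V N) (chain_boundary N ?g)"
        using singular_chain_boundary [OF g] Suc by simp
      note chain_boundary_push_homotopy [OF E _ this]
      \<comment> \<open>The homotopy formula in degree \<open>M\<close>, applied to the boundary of
        the graph: its last term contains a double boundary and drops out. This cancels the other
        terms in the boundary of \<open>B s\<close>.\<close>
      ultimately have "chain_boundary N (push_homotopy E (N - 1) (chain_boundary N ?g))
          = chain_boundary N ?g - chain_boundary N (frag_of (graph_simplex N (\<lambda>t. x)))"
        using Suc by simp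
      then have "chain_boundary N (B s) = 0"
        by (simp add: B_def chain_boundary_diff)
      then show ?thesis
        using B_ch Suc by (simp add: reduced_cycle_positive singular_cycle)
    qed
    then have "singular_relboundary N (?P U N) {} (B s)"
      using reduced_null_prod_contractible [OF null \<open>W \<subseteq> U\<close> contractible_space_standard_simplex]
      by (blast intro: reduced_nullD)
    then show ?thesis
      by (simp add: singular_boundary)
  qed
  define E' where "E' = E(N := \<lambda>s. SOME d. singular_chain (Suc N) (?P U N) d \<and> chain_boundary (Suc N) d = B s)"
  have E'_N: "singular_chain (Suc N) (?P U N) (E' N s) \<and> chain_boundary (Suc N) (E' N s) = B s"
    if "singular_simplex N (subtopology X V) s" for s
    using someI_ex [OF B_bounds [OF that]] by (simp add: E'_def)
  \<comment> \<open>Only degree \<open>N\<close> of \<open>E\<close> was changed. The truncated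
    \<open>n - 1\<close> hits it just for \<open>n = N = 0\<close>, where the boundary is
    zero.\<close>
  have push_eq: "push_homotopy E' (n - 1) (chain_boundary n c) = push_homotopy E (n - 1) (chain_boundary n c)"
    if "n \<le> N" for n and c :: "('a \<times> (nat \<Rightarrow> real)) chain"
  proof (cases n)
    case (Suc m)
    then show ?thesis
      using that by (simp add: push_homotopy_def E'_def)
  qed (simp add: chain_boundary_def)
  have "graph_contraction (Suc N) (subtopology X V) (subtopology X U) x E'"
    unfolding graph_contraction_def
  proof (intro allI impI)
    fix n s
    assume n: "n < Suc N" and s: "singular_simplex n (subtopology X V) s"
    show "singular_chain (Suc n) (?P U n) (E' n s) \<and>
          chain_boundary (Suc n) (E' n s) =
            frag_of (graph_simplex n s) - frag_of (graph_simplex n (\<lambda>t. x))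
              - push_homotopy E' (n - 1) (chain_boundary n (frag_of (graph_simplex n s)))"
    proof (cases "n = N")
      case True
      then show ?thesis
        using E'_N s push_eq [of N] by (simp add: B_def)
    next
      case False
      then have "n < N" and "E' n = E n"
        using n by (auto simp: E'_def)
      then show ?thesis
        using E s push_eq [of n] singular_chain_prod_mono [OF _ \<open>W \<subseteq> U\<close>, of "Suc n" X "simplex_topology n" "E n s"]
        by (simp add: graph_contraction_def)
    qed
  qed
  then show ?thesis by (rule exI [of _ E'])
qed

text \<open>The top degree shrinks first: HLC in degree \<open>N\<close> yields \<open>W\<close>
  inside \<open>U\<close>, and the lower degrees are then built with target \<open>W\<close>. Hence
  \<open>U\<close> must vary in the induction.\<close>

lemma HLC_imp_graph_contraction:
  assumes "HLC X" "x \<in> topspace X" "nbhd_of X x U"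
  shows "\<exists>V E. nbhd_of X x V \<and> V \<subseteq> U \<and> graph_contraction N (subtopology X V) (subtopology X U) x E"
  using assms(3)
proof (induction N arbitrary: U)
  case 0
  then show ?case
    by (auto simp: graph_contraction_def)
next
  case (Suc N)
  obtain W where W: "nbhd_of X x W" "W \<subseteq> U" "reduced_null N (subtopology X W) (subtopology X U)"
    using HLC_D [OF assms(1,2) Suc.prems] by blast
  then obtain V E where V: "nbhd_of X x V" "V \<subseteq> W"
      and E: "graph_contraction N (subtopology X V) (subtopology X W) x E"
    using Suc.IH by blast
  have "x \<in> W"
    using W(1) by (auto simp: nbhd_of_def)
  then obtain E' where "graph_contraction (Suc N) (subtopology X V) (subtopology X U) x E'"
    using graph_contraction_Suc [OF E V(2) W(2) assms(2)] W(3) by blast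
  then show ?case
    using V W(2) by blast
qed

section \<open>Products\<close>

text \<open>The set \<open>U\<close> is pulled back along \<open>r\<close>, HLC of \<open>Z\<close>
  is applied at \<open>i x\<close>, and the resulting neighbourhood is pulled back along
  \<open>i\<close>; \<open>reduced_null_factor\<close> transfers the vanishing.\<close>

lemma HLC_retract:
  assumes HLC: "HLC Z" and "retraction_maps Z X r i"
  shows "HLC X"
  unfolding HLC_iff_reduced_null
proof (intro ballI allI impI)
  have r: "continuous_map Z X r" and i: "continuous_map X Z i"
    and ri: "\<And>x. x \<in> topspace X \<Longrightarrow> r (i x) = x"
    using assms(2) by (auto simp: retraction_maps_def)
  fix x U n
  assume x: "x \<in> topspace X" and U: "nbhd_of X x U"
  have ix: "i x \<in> topspace Z"
    using x i by (auto simp: continuous_map_def)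
  let ?U = "{z \<in> topspace Z. r z \<in> U}"
  obtain U' where U': "openin X U'" "x \<in> U'" "U' \<subseteq> U"
    using U by (auto simp: nbhd_of_def)
  have "openin Z {z \<in> topspace Z. r z \<in> U'}"
    using r U'(1) by (rule openin_continuous_map_preimage)
  moreover have "i x \<in> {z \<in> topspace Z. r z \<in> U'}" "{z \<in> topspace Z. r z \<in> U'} \<subseteq> ?U"
    using x ix ri U' by auto
  ultimately have "nbhd_of Z (i x) ?U"
    unfolding nbhd_of_def by blast
  then obtain V where V: "nbhd_of Z (i x) V" "V \<subseteq> ?U"
      and null: "reduced_null n (subtopology Z V) (subtopology Z ?U)"
    using HLC_D [OF HLC ix] by blast
  obtain V' where V': "openin Z V'" "i x \<in> V'" "V' \<subseteq> V"
    using V(1) by (auto simp: nbhd_of_def)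
  let ?W = "{x \<in> topspace X. i x \<in> V'}"
  have "openin X ?W"
    using i V'(1) by (rule openin_continuous_map_preimage)
  then have "nbhd_of X x ?W"
    using x V' unfolding nbhd_of_def by blast
  moreover have "?W \<subseteq> U"
    using V(2) V'(3) ri by force
  moreover have "reduced_null n (subtopology X ?W) (subtopology X U)"
  proof (rule reduced_null_factor [OF null])
    show "continuous_map (subtopology X ?W) (subtopology Z V) i"
      using i V'(3) by (auto simp: continuous_map_in_subtopology continuous_map_from_subtopology)
    show "continuous_map (subtopology Z ?U) (subtopology X U) r"
      using r by (auto simp: continuous_map_in_subtopology continuous_map_from_subtopology)
  qed (use ri in auto)
  ultimately show "\<exists>V. nbhd_of X x V \<and> V \<subseteq> U \<and> reduced_null n (subtopology X V) (subtopology X U)"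
    by blast
qed

text \<open>The point \<open>y\<close> supplies the slice embedding \<open>X\<close>. With
  \<open>Y\<close> empty the product would be empty, hence HLC for any \<open>X\<close>.\<close>

lemma HLC_prod_imp_fst:
  assumes "HLC (prod_topology X Y)" "y \<in> topspace Y"
  shows "HLC X"
  using assms(1)
proof (rule HLC_retract)
  show "retraction_maps (prod_topology X Y) X fst (\<lambda>x. (x, y))"
    using assms(2) by (simp add: retraction_maps_def continuous_map_fst continuous_map_pairedI)
qed

lemma HLC_prod_imp_snd:
  assumes "HLC (prod_topology X Y)" "x \<in> topspace X"
  shows "HLC Y"
  using assms(1)
proof (rule HLC_retract)
  show "retraction_maps (prod_topology X Y) Y snd (\<lambda>y. (x, y))"
    using assms(2) by (simp add: retraction_maps_def continuous_map_snd continuous_map_pairedI)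
qed

section \<open>Products of HLC spaces\<close>

lemma HLC_prod:
  assumes X: "HLC X" and Y: "HLC Y"
  shows "HLC (prod_topology X Y)"
  unfolding HLC_iff_reduced_null
proof (intro ballI allI impI)
  fix p U n
  let ?XY = "prod_topology X Y"
  assume "p \<in> topspace ?XY" and U: "nbhd_of ?XY p U"
  then obtain x y where p: "p = (x, y)" and x: "x \<in> topspace X" and y: "y \<in> topspace Y"
    by auto
  obtain A B where A: "openin X A" "x \<in> A" and B: "openin Y B" "y \<in> B" and AB: "A \<times> B \<subseteq> U"
    using U unfolding p nbhd_of_def by (auto simp: openin_prod_topology_alt) (meson dual_order.trans)
  have "nbhd_of X x A" "nbhd_of Y y B"
    using A B openin_subset by (auto simp: nbhd_of_def)
  then obtain V E where V: "nbhd_of X x V" "V \<subseteq> A"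
      \<comment> \<open>The bound is strict, so \<open>Suc n\<close> provides the homotopy in degree
        \<open>n\<close>.\<close>
      and E: "graph_contraction (Suc n) (subtopology X V) (subtopology X A) x E"
    using HLC_imp_graph_contraction [OF X x] by blast
  obtain W where W: "nbhd_of Y y W" "W \<subseteq> B" and null: "reduced_null n (subtopology Y W) (subtopology Y B)"
    using HLC_D [OF Y y \<open>nbhd_of Y y B\<close>] by blast
  let ?V = "subtopology X V" and ?A = "subtopology X A"
    and ?W = "subtopology Y W" and ?B = "subtopology Y B"
  have "reduced_null n (prod_topology ?V ?W) (prod_topology ?A ?B)"
    unfolding reduced_null_def
  proof (intro allI impI)
    fix c assume red: "reduced_cycle n (prod_topology ?V ?W) c"
    then have c: "singular_chain n (prod_topology ?V ?W) c" "chain_boundary n c = 0"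
      by (auto simp: reduced_cycle_def singular_cycle)
    have "singular_relboundary n ?B {} (chain_map n snd c)"
      using red null continuous_map_snd by (blast intro: reduced_nullD reduced_cycle_chain_map)
    moreover have "continuous_map ?B (prod_topology ?A ?B) (\<lambda>b. (x, b))"
      using x A by (simp add: continuous_map_pairedI)
    ultimately have "singular_relboundary n (prod_topology ?A ?B) {} (chain_map n (\<lambda>b. (x, b)) (chain_map n snd c))"
      by (rule singular_relboundary_chain_map) auto
    \<comment> \<open>Collapsing the first coordinate factors through \<open>snd\<close>, so the
      filling in \<open>Y\<close> bounds the collapsed cycle in the fibre over
      \<open>x\<close>.\<close>
    then have x_bd: "singular_relboundary n (prod_topology ?A ?B) {} (chain_map n (\<lambda>z. (x, snd z)) c)"
      by (simp add: chain_map_compose_apply o_def)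
    have "singular_chain (Suc n) (prod_topology ?A ?W) (push_homotopy E n c)"
      using singular_chain_push_homotopy [OF E _ c(1)] by simp
    then have "singular_chain (Suc n) (prod_topology ?A ?B) (push_homotopy E n c)"
      using W(2) singular_chain_mono [of "Suc n" ?XY "A \<times> W" _ "A \<times> B"]
      by (auto simp: subtopology_Times)
    \<comment> \<open>The third term of the homotopy formula vanishes because \<open>c\<close> is a
      cycle.\<close>
    moreover have "chain_boundary (Suc n) (push_homotopy E n c) = c - chain_map n (\<lambda>z. (x, snd z)) c"
      using chain_boundary_push_homotopy [OF E _ c(1)] c(2) by simp
    ultimately have "singular_relboundary n (prod_topology ?A ?B) {} (c - chain_map n (\<lambda>z. (x, snd z)) c)"
      by (auto simp: singular_boundary)
    then show "singular_relboundary n (prod_topology ?A ?B) {} c"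
      using singular_relboundary_add [OF _ x_bd] by fastforce
  qed
  then have "reduced_null n (subtopology ?XY (V \<times> W)) (subtopology ?XY U)"
    using AB by (auto simp: reduced_null_def subtopology_Times [symmetric] intro: singular_boundary_mono)
  moreover have "nbhd_of ?XY p (V \<times> W)"
  proof -
    obtain V' W' where "openin X V'" "x \<in> V'" "V' \<subseteq> V" "openin Y W'" "y \<in> W'" "W' \<subseteq> W"
      using V(1) W(1) by (auto simp: nbhd_of_def)
    then have "openin ?XY (V' \<times> W')" "p \<in> V' \<times> W'" "V' \<times> W' \<subseteq> V \<times> W"
      by (auto simp: openin_prod_Times_iff p)
    then show ?thesis
      using V(1) W(1) unfolding nbhd_of_def by auto
  qed
  moreover have "V \<times> W \<subseteq> U"
    using V(2) W(2) AB by blast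
  ultimately show "\<exists>V. nbhd_of ?XY p V \<and> V \<subseteq> U \<and> reduced_null n (subtopology ?XY V) (subtopology ?XY U)"
    by blast
qed

theorem theorem3p5:
  fixes X :: "'a topology" and Y :: "'b topology"
  assumes "topspace X \<noteq> {}" and "topspace Y \<noteq> {}"
  shows "HLC (prod_topology X Y) \<longleftrightarrow> HLC X \<and> HLC Y"
  using assms HLC_prod [of X Y] HLC_prod_imp_fst [of X Y] HLC_prod_imp_snd [of X Y] by blast

end
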